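(* Let $K_1,K_2\subset\mathbb{R}$ be compact sets. If \[ K_1\subset c_1K_2\cup\cdots\cup c_sK_2 \] for finitely many nonzero real scalars $c_1,\ldots,c_s$, then $\sigma_{K_1}\subseteq\sigma_{K_2}$ (inclusion of the families of open sets).
   Context: For $x\in\mathbb{R}$ write $\|x\|_{\mathbb{T}}=\operatorname{dist}(x,\mathbb{Z})=\inf_{m\in\mathbb{Z}}|x-m|$. For $c\in\mathbb{R}$ and $K\subset\mathbb{R}$, $cK=\{cu:u\in K\}$. For a compact set $K\subset\mathbb{R}$ (a "compact scalar set"), a finite nonempty set $A\subset\mathbb{R}\setminus\{0\}$ and $\varepsilon>0$, put \[ p_{A,K}(x)=\sup_{a\in A,\ u\in K}\|a\,u\,x\|_{\mathbb{T}},\qquad U_K(A,\varepsilon)=\{x\in\mathbb{R}:p_{A,K}(x)<\varepsilon\}, \] with the convention that a supremum over the empty set is $0$. The topology $\sigma_K$ is the translation-invariant topology on $\mathbb{R}$ generated by the sets $U_K(A,\varepsilon)$, i.e. the topology for which these sets (over all finite nonempty $A\subset\mathbb{R}\setminus\{0\}$ and all $\varepsilon>0$) form a neighborhood base at zero. *)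

theory Defs
  imports "HOL-Analysis.Analysis"
begin

definition torus_norm :: "real \<Rightarrow> real" where
  "torus_norm x = infdist x \<int>"

text \<open>The library supremum of the empty set of reals is unspecified, hence the case distinction
  for the convention that it is 0.  For nonempty sets the supremum is over a set bounded by 1/2.\<close>

definition p_scalar :: "real set \<Rightarrow> real set \<Rightarrow> real \<Rightarrow> real" where
  "p_scalar A K x =
     (if A = {} \<or> K = {} then 0 else (SUP (a, u)\<in>A \<times> K. torus_norm (a * u * x)))"

definition U_scalar :: "real set \<Rightarrow> real set \<Rightarrow> real \<Rightarrow> real set" where
  "U_scalar K A \<epsilon> = {x. p_scalar A K x < \<epsilon>}"

definition scalar_nbhds :: "real set \<Rightarrow> real set set" where
  "scalar_nbhds K = {U_scalar K A \<epsilon> | A \<epsilon>. finite A \<and> A \<noteq> {} \<and> 0 \<notin> A \<and> 0 < \<epsilon>}"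

text \<open>The coarsest translation-invariant topology in which all sets in \<^term>\<open>scalar_nbhds K\<close>
  are open.  By \<open>openin_sigma_top_iff\<close> below, it is the translation-invariant topology having
  these sets as a neighborhood base at zero.\<close>

definition sigma_top :: "real set \<Rightarrow> real topology" where
  "sigma_top K = topology_generated_by {(+) t ` U | t U. U \<in> scalar_nbhds K}"

lemma torus_norm_bounds: "0 \<le> torus_norm x" "torus_norm x \<le> 1/2"
proof -
  show "0 \<le> torus_norm x" by (simp add: torus_norm_def infdist_nonneg)
  have "infdist x \<int> \<le> dist x (of_int (round x))"
    by (rule infdist_le) simp
  also have "\<dots> \<le> 1/2"
    using of_int_round_abs_le[of x] by (simp add: dist_real_def abs_minus_commute)
  finally show "torus_norm x \<le> 1/2" by (simp add: torus_norm_def)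
qed

lemma torus_norm_add: "torus_norm (x + y) \<le> torus_norm x + torus_norm y"
proof (rule field_le_epsilon)
  fix e :: real assume e: "0 < e"
  have ne: "(\<int> :: real set) \<noteq> {}" by auto
  have ex: "\<exists>m\<in>\<int>. dist z m < torus_norm z + e/2" for z :: real
  proof -
    have "(INF m\<in>\<int>. dist z m) < torus_norm z + e/2"
      using e by (simp add: torus_norm_def infdist_notempty[OF ne])
    then show ?thesis
      by (subst (asm) cINF_less_iff[OF ne]) (auto intro: bdd_belowI[of _ 0])
  qed
  obtain m n where "m \<in> \<int>" "dist x m < torus_norm x + e/2" "n \<in> \<int>" "dist y n < torus_norm y + e/2"
    using ex by meson
  moreover have "torus_norm (x + y) \<le> dist (x + y) (m + n)"
    unfolding torus_norm_def by (rule infdist_le) (use calculation in auto)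
  moreover have "dist (x + y) (m + n) \<le> dist x m + dist y n"
    by (simp add: dist_real_def)
  ultimately show "torus_norm (x + y) \<le> torus_norm x + torus_norm y + e" by linarith
qed

lemma torus_norm_le_p_scalar:
  assumes "a \<in> A" "u \<in> K"
  shows "torus_norm (a * u * x) \<le> p_scalar A K x"
proof -
  have "bdd_above ((\<lambda>(a, u). torus_norm (a * u * x)) ` (A \<times> K))"
    by (rule bdd_aboveI2[of _ _ "1/2"]) (clarify, rule torus_norm_bounds(2))
  from cSUP_upper[OF _ this, of "(a, u)"] show ?thesis
    using assms by (auto simp: p_scalar_def)
qed

lemma p_scalar_leI:
  assumes "\<And>a u. a \<in> A \<Longrightarrow> u \<in> K \<Longrightarrow> torus_norm (a * u * x) \<le> b" "0 \<le> b"
  shows "p_scalar A K x \<le> b"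
  using assms by (auto simp: p_scalar_def intro!: cSUP_least)

lemma p_scalar_nonneg: "0 \<le> p_scalar A K x"
proof (cases "A = {} \<or> K = {}")
  case False
  then obtain a u where "a \<in> A" "u \<in> K" by auto
  then show ?thesis using torus_norm_le_p_scalar torus_norm_bounds(1) order_trans by blast
qed (auto simp: p_scalar_def)

lemma p_scalar_zero [simp]: "p_scalar A K 0 = 0"
proof (rule antisym)
  show "p_scalar A K 0 \<le> 0" by (rule p_scalar_leI) (auto simp: torus_norm_def)
qed (rule p_scalar_nonneg)

lemma p_scalar_add: "p_scalar A K (x + y) \<le> p_scalar A K x + p_scalar A K y"
proof (rule p_scalar_leI)
  fix a u assume "a \<in> A" "u \<in> K"
  then have "torus_norm (a * u * x) \<le> p_scalar A K x" "torus_norm (a * u * y) \<le> p_scalar A K y"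
    by (auto intro: torus_norm_le_p_scalar)
  moreover have "torus_norm (a * u * (x + y)) \<le> torus_norm (a * u * x) + torus_norm (a * u * y)"
    using torus_norm_add[of "a * u * x" "a * u * y"] by (simp add: distrib_left)
  ultimately show "torus_norm (a * u * (x + y)) \<le> p_scalar A K x + p_scalar A K y" by linarith
qed (simp add: p_scalar_nonneg)

lemma p_scalar_mono: "A \<subseteq> B \<Longrightarrow> p_scalar A K x \<le> p_scalar B K x"
  by (rule p_scalar_leI) (auto intro: torus_norm_le_p_scalar simp: p_scalar_nonneg)

lemma openin_sigma_top_iff:
  "openin (sigma_top K) W \<longleftrightarrow> (\<forall>x\<in>W. \<exists>U\<in>scalar_nbhds K. (+) x ` U \<subseteq> W)"
proof
  define G where "G = {(+) t ` U | t U. U \<in> scalar_nbhds K}"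
  assume "openin (sigma_top K) W"
  then have "generate_topology_on G W"
    by (simp add: sigma_top_def G_def openin_topology_generated_by_iff)
  then show "\<forall>x\<in>W. \<exists>U\<in>scalar_nbhds K. (+) x ` U \<subseteq> W"
  proof induction
    case (Int V W)
    show ?case
    proof
      fix x assume "x \<in> V \<inter> W"
      with Int.IH obtain U1 U2 where U: "U1 \<in> scalar_nbhds K" "U2 \<in> scalar_nbhds K"
        "(+) x ` U1 \<subseteq> V" "(+) x ` U2 \<subseteq> W" by blast
      then obtain A d B e where AB: "U1 = U_scalar K A d" "finite A" "A \<noteq> {}" "0 \<notin> A" "0 < d"
        "U2 = U_scalar K B e" "finite B" "B \<noteq> {}" "0 \<notin> B" "0 < e"
        unfolding scalar_nbhds_def by blast
      have *: "U_scalar K (A \<union> B) (min d e) \<in> scalar_nbhds K"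
        using AB unfolding scalar_nbhds_def
        by (intro CollectI exI[of _ "A \<union> B"] exI[of _ "min d e"]) auto
      have "U_scalar K (A \<union> B) (min d e) \<subseteq> U1 \<inter> U2"
      proof
        fix y assume "y \<in> U_scalar K (A \<union> B) (min d e)"
        then show "y \<in> U1 \<inter> U2"
          using p_scalar_mono[of A "A \<union> B" K y] p_scalar_mono[of B "A \<union> B" K y]
          by (auto simp: AB U_scalar_def)
      qed
      then have "(+) x ` U_scalar K (A \<union> B) (min d e) \<subseteq> V \<inter> W" using U by blast
      with * show "\<exists>U\<in>scalar_nbhds K. (+) x ` U \<subseteq> V \<inter> W" by blast
    qed
  next
    case (UN \<K>)
    then show ?case by (meson Union_iff Union_upper order_trans)
  next
    case (Basis S)
    then obtain t A e where S: "S = (+) t ` U_scalar K A e" "finite A" "A \<noteq> {}" "0 \<notin> A" "0 < e"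
      unfolding G_def scalar_nbhds_def by blast
    show ?case
    proof
      fix x assume "x \<in> S"
      then have x: "p_scalar A K (x - t) < e" by (auto simp: S U_scalar_def)
      let ?U = "U_scalar K A (e - p_scalar A K (x - t))"
      have "?U \<in> scalar_nbhds K" unfolding scalar_nbhds_def using S x
        by (intro CollectI exI[of _ A] exI[of _ "e - p_scalar A K (x - t)"]) auto
      moreover have "(+) x ` ?U \<subseteq> S"
      proof
        fix z assume "z \<in> (+) x ` ?U"
        then obtain y where y: "z = x + y" "p_scalar A K y < e - p_scalar A K (x - t)"
          by (auto simp: U_scalar_def)
        have "p_scalar A K (z - t) < e"
          using p_scalar_add[of A K "x - t" y] y by (simp add: algebra_simps)
        then show "z \<in> S" unfolding S U_scalar_def by (auto intro!: image_eqI[of _ _ "z - t"])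
      qed
      ultimately show "\<exists>U\<in>scalar_nbhds K. (+) x ` U \<subseteq> S" by blast
    qed
  qed auto
next
  assume W: "\<forall>x\<in>W. \<exists>U\<in>scalar_nbhds K. (+) x ` U \<subseteq> W"
  then obtain U where U: "\<And>x. x \<in> W \<Longrightarrow> U x \<in> scalar_nbhds K" "\<And>x. x \<in> W \<Longrightarrow> (+) x ` U x \<subseteq> W"
    by metis
  have "0 \<in> U x" if "x \<in> W" for x
    using U(1)[OF that] by (auto simp: scalar_nbhds_def U_scalar_def)
  then have "W = (\<Union>x\<in>W. (+) x ` U x)" using U(2) by (force intro: image_eqI[of _ _ 0])
  moreover have "openin (sigma_top K) (\<Union>x\<in>W. (+) x ` U x)"
    unfolding sigma_top_def using U(1)
    by (intro openin_Union) (auto intro!: topology_generated_by_Basis)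
  ultimately show "openin (sigma_top K) W" by simp
qed

end

theory Submission
  imports Defs
begin

text \<open>The scalars \<open>c i\<close> can be absorbed into the finite set \<open>A\<close>: if
  \<open>u = c i * v\<close> with \<open>v\<close> in \<open>K2\<close>, then
  \<open>a * u * x = (a * c i) * v * x\<close>. So \<open>p_scalar A K1\<close> is at most
  \<open>p_scalar B K2\<close> once \<open>B\<close> contains all products \<open>a * c i\<close>,
  and every basic neighborhood of zero for \<open>K1\<close> contains one for \<open>K2\<close>
  (\<open>scalar_nbhds_refine\<close>). Translation, via \<open>openin_sigma_top_iff\<close>,
  carries this to open sets.\<close>

lemma p_scalar_le_of_cover:
  assumes "K1 \<subseteq> (\<Union>i\<in>I. (\<lambda>u. c i * u) ` K2)"
    and "(\<lambda>(a, i). a * c i) ` (A \<times> I) \<subseteq> B"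
  shows "p_scalar A K1 x \<le> p_scalar B K2 x"
proof (rule p_scalar_leI)
  fix a u assume "a \<in> A" "u \<in> K1"
  then obtain i v where iv: "i \<in> I" "v \<in> K2" "u = c i * v"
    using assms(1) by blast
  have "a * c i \<in> B" using assms(2) \<open>a \<in> A\<close> iv(1) by auto
  from torus_norm_le_p_scalar[OF this iv(2), of x]
  show "torus_norm (a * u * x) \<le> p_scalar B K2 x"
    by (simp add: iv(3) mult.assoc)
\<comment> \<open>The bound must also be nonnegative, because the supremum is 0 by convention when
  \<open>A\<close> or \<open>K1\<close> is empty.\<close>
qed (rule p_scalar_nonneg)

text \<open>Finiteness of \<open>I\<close> keeps the enlarged set \<open>B\<close> finite, and
  \<open>c i \<noteq> 0\<close> keeps 0 out of it, so \<open>B\<close> is admissible; the radius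
  \<open>e\<close> is unchanged.\<close>

lemma scalar_nbhds_refine:
  assumes "finite I" and "\<And>i. i \<in> I \<Longrightarrow> c i \<noteq> 0"
    and "K1 \<subseteq> (\<Union>i\<in>I. (\<lambda>u. c i * u) ` K2)"
    and "U \<in> scalar_nbhds K1"
  shows "\<exists>V\<in>scalar_nbhds K2. V \<subseteq> U"
proof -
  obtain A e where A: "U = U_scalar K1 A e" "finite A" "A \<noteq> {}" "0 \<notin> A" "0 < e"
    using assms(4) unfolding scalar_nbhds_def by blast
  \<comment> \<open>\<open>A\<close> is included only to keep \<open>B\<close> nonempty when \<open>I = {}\<close>.\<close>
  define B where "B = A \<union> (\<lambda>(a, i). a * c i) ` (A \<times> I)"
  have "finite B" "B \<noteq> {}" "0 \<notin> B"
    using A assms(1,2) by (auto simp: B_def)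
  then have "U_scalar K2 B e \<in> scalar_nbhds K2"
    using A(5) unfolding scalar_nbhds_def by blast
  moreover have "p_scalar A K1 x \<le> p_scalar B K2 x" for x
    by (rule p_scalar_le_of_cover[OF assms(3)]) (simp add: B_def)
  then have "U_scalar K2 B e \<subseteq> U"
    unfolding A(1) U_scalar_def using le_less_trans by blast
  ultimately show ?thesis by blast
qed

theorem proposition4p1:
  fixes K1 K2 :: "real set" and c :: "nat \<Rightarrow> real" and s :: nat
  assumes "compact K1" and "compact K2"
    and "\<And>i. i \<in> {1..s} \<Longrightarrow> c i \<noteq> 0"
    and "K1 \<subseteq> (\<Union>i\<in>{1..s}. (\<lambda>u. c i * u) ` K2)"
  shows "{W. openin (sigma_top K1) W} \<subseteq> {W. openin (sigma_top K2) W}"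
proof (intro subsetI CollectI)
  fix W assume "W \<in> {W. openin (sigma_top K1) W}"
  then have W: "\<forall>x\<in>W. \<exists>U\<in>scalar_nbhds K1. (+) x ` U \<subseteq> W"
    by (simp add: openin_sigma_top_iff)
  show "openin (sigma_top K2) W"
    unfolding openin_sigma_top_iff
  proof
    fix x assume "x \<in> W"
    then obtain U where U: "U \<in> scalar_nbhds K1" "(+) x ` U \<subseteq> W"
      using W by blast
    \<comment> \<open>Shrinking \<open>U\<close> to \<open>V\<close> keeps its translate by
      \<open>x\<close> inside \<open>W\<close>.\<close>
    obtain V where "V \<in> scalar_nbhds K2" "V \<subseteq> U"
      using scalar_nbhds_refine[OF _ assms(3,4) U(1)] by auto
    then show "\<exists>V\<in>scalar_nbhds K2. (+) x ` V \<subseteq> W"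
      using U(2) by blast
  qed
qed

end
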